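(* Let $q$ be a prime power, $r\ge1$ an integer, and $\alpha_1,\ldots,\alpha_r\in\mathfrak p=t^{-1}\mathbb F_q[[t^{-1}]]$. (1) For every $n\ge0$, if $d=L_r(n)$ and $N=n+d-1$, then $\mathcal L_r(N)=d-1$. (2) If no nonzero polynomial $Q\in\mathbb F_q[t]$ has infinite common cancellation depth $m_r(Q)$, then, for every integer $D\ge1$, $$R^{(r)}_D=\max_{\substack{N\in\{0,1,2,\ldots\}\\ \mathcal L_r(N)+1\le D}}\bigl(rN-(r+1)\mathcal L_r(N)-1\bigr).$$
   Context: Write $\alpha_i=\sum_{j\ge1}u^{(i)}_jt^{-j}$ with $u^{(i)}_j\in\mathbb F_q$. For $x\in\mathbb F_q((t^{-1}))$ the cancellation length $c(x)$ is the largest $n\ge0$ such that the coefficients of $t^{-1},\ldots,t^{-n}$ in $x$ all vanish ($c(x)=\infty$ if all negative coefficients vanish). For nonzero $Q\in\mathbb F_q[t]$ put $d(Q)=\deg Q+1$ and let $m_r(Q)=\min_{1\le i\le r}c(Q\alpha_i)$ be the common cancellation depth. Define $$L_r(n)=\min\{d(Q):0\ne Q\in\mathbb F_q[t],\ m_r(Q)\ge n\}\quad(n\ge0),\qquad R^{(r)}_D=\max_{\substack{0\ne Q\in\mathbb F_q[t]\\ d(Q)\le D}}\bigl(r\,m_r(Q)-d(Q)\bigr)\quad(D\ge1).$$ Joint linear complexity: for $N\ge0$, $\mathcal L_r(N)$ is the least integer $0\le\ell\le N$ for which there exist $a_0,\ldots,a_\ell\in\mathbb F_q$ with $a_\ell\ne0$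 such that $\sum_{k=0}^{\ell}a_ku^{(i)}_{j+k}=0$ for every $1\le i\le r$ and every $1\le j\le N-\ell$. In particular $\mathcal L_r(0)=0$, and for $N\ge1$, $\mathcal L_r(N)=0$ exactly when the first $N$ coefficient vectors are all zero. *)

theory Defs
  imports
    "HOL-Computational_Algebra.Formal_Laurent_Series"
    "HOL-Library.Extended_Real"
begin

text \<open>
  The field \<open>F\<^sub>q((t\<^sup>-\<^sup>1))\<close> is \<^typ>\<open>'a fls\<close> with \<^const>\<open>fls_X\<close> playing the role of \<open>t\<^sup>-\<^sup>1\<close>, where
  \<open>'a\<close> is a finite field; the coefficient of \<open>t\<^sup>-\<^sup>j\<close> in \<open>x\<close> is thus \<open>fls_nth x j\<close>, and \<open>t\<close>
  itself is \<^const>\<open>fls_X_inv\<close>.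
\<close>

definition frak_p :: "'a::field fls set" where
  "frak_p = range (\<lambda>f. fls_X * fps_to_fls f)"

definition poly_to_fls :: "'a::field poly \<Rightarrow> 'a fls" where
  "poly_to_fls Q = poly (map_poly fls_const Q) fls_X_inv"

lemma poly_to_fls_pCons:
  "poly_to_fls (pCons a Q) = fls_const a + fls_X_inv * poly_to_fls Q"
  by (cases "a = 0 \<and> Q = 0") (auto simp: poly_to_fls_def map_poly_pCons)

lemma poly_to_fls_nth:
  "fls_nth (poly_to_fls Q) n = (if n \<le> 0 then coeff Q (nat (- n)) else 0)"
proof (induction Q arbitrary: n)
  case 0
  then show ?case by (simp add: poly_to_fls_def)
next
  case (pCons a Q)
  have "nat (- n) = Suc (nat (- (n + 1)))" if "n < 0"
    using that by simp
  then show ?case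
    by (auto simp: poly_to_fls_pCons fls_X_inv_times_conv_shift pCons.IH)
qed

definition canc_length :: "'a::field fls \<Rightarrow> enat" where
  "canc_length x =
    (if \<forall>j\<ge>1. fls_nth x j = 0 then \<infinity>
     else enat (GREATEST n. \<forall>j\<in>{1..n}. fls_nth x (int j) = 0))"

definition poly_d :: "'a::field poly \<Rightarrow> nat" where
  "poly_d Q = degree Q + 1"

definition canc_depth :: "nat \<Rightarrow> (nat \<Rightarrow> 'a::field fls) \<Rightarrow> 'a poly \<Rightarrow> enat" where
  "canc_depth r \<alpha> Q = Min ((\<lambda>i. canc_length (poly_to_fls Q * \<alpha> i)) ` {1..r})"

definition min_poly_d :: "nat \<Rightarrow> (nat \<Rightarrow> 'a::field fls) \<Rightarrow> nat \<Rightarrow> nat" where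
  "min_poly_d r \<alpha> n = (LEAST d. \<exists>Q. Q \<noteq> 0 \<and> canc_depth r \<alpha> Q \<ge> enat n \<and> d = poly_d Q)"

text \<open>
  Extended-real valued, since the depth may be infinite. Over a finite field only finitely many
  \<open>Q\<close> satisfy \<open>poly_d Q \<le> D\<close>, so \<^const>\<open>Max\<close> is a genuine maximum for \<open>D \<ge> 1\<close>.
\<close>
definition max_canc_gain :: "nat \<Rightarrow> (nat \<Rightarrow> 'a::{field,finite} fls) \<Rightarrow> nat \<Rightarrow> ereal" where
  "max_canc_gain r \<alpha> D =
    Max ((\<lambda>Q. ereal (real r) * ereal_of_enat (canc_depth r \<alpha> Q) - ereal (real (poly_d Q)))
         ` {Q. Q \<noteq> 0 \<and> poly_d Q \<le> D})"

definition joint_lin_complexity :: "nat \<Rightarrow> (nat \<Rightarrow> 'a::field fls) \<Rightarrow> nat \<Rightarrow> nat" where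
  "joint_lin_complexity r \<alpha> N =
    (LEAST l. l \<le> N \<and> (\<exists>a. a l \<noteq> 0 \<and>
       (\<forall>i\<in>{1..r}. \<forall>j\<in>{1..N - l}. (\<Sum>k\<le>l. a k * fls_nth (\<alpha> i) (int (j + k))) = 0)))"

text \<open>An existing maximum, as opposed to \<^const>\<open>Max\<close>, which is unspecified on infinite sets.\<close>
definition is_max_of :: "'b::linorder set \<Rightarrow> 'b \<Rightarrow> bool" where
  "is_max_of S m \<longleftrightarrow> m \<in> S \<and> (\<forall>x\<in>S. x \<le> m)"

end

theory Submission
  imports Defs
begin

text \<open>
  A polynomial \<open>Q\<close> of degree exactly \<open>l\<close> is the same thing as a linear recurrence of length \<open>l\<close>
  with nonzero top coefficient, and the coefficient of \<open>t\<^sup>-\<^sup>j\<close> in \<open>Q \<alpha>\<^sub>i\<close> is the residual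
  \<open>\<Sum>k\<le>l. a\<^sub>k u\<^sub>j\<^sub>+\<^sub>k\<close> of that recurrence at position \<open>j\<close>. Since checking the recurrence on the first
  \<open>N\<close> terms means checking the positions \<open>1, \<dots>, N - l\<close>, the joint linear complexity at \<open>N\<close> is the
  least degree \<open>l \<le> N\<close> of a nonzero \<open>Q\<close> with depth at least \<open>N - l\<close>
  (\<open>joint_lin_complexity_eq_Least_degree\<close>). Everything else is bookkeeping along the substitution
  \<open>N = n + deg Q\<close>.

  For the first claim, a \<open>Q\<close> of least degree among those of depth at least \<open>n\<close> is admissible at
  \<open>N = n + deg Q\<close>, and anything of smaller degree admissible at this \<open>N\<close> would have depth greater
  than \<open>n\<close>. That some \<open>Q\<close> of depth at least \<open>n\<close> exists at all is a pigeonhole argument over the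
  finite field (\<open>exists_canc_depth_ge\<close>).

  For the second claim, put \<open>l = deg Q\<close>, so that \<open>N = n + l\<close> gives
  \<open>r N - (r + 1) l - 1 = r n - (l + 1)\<close>. A polynomial realising the complexity at \<open>N\<close> therefore has
  gain at least the value at \<open>N\<close>, while a polynomial of depth \<open>n\<close> bounds the complexity at
  \<open>N = n + l\<close> by \<open>l\<close>, so the value there is at least its gain. Hence the two maxima dominate each
  other, and a maximiser on the polynomial side yields one on the other side.
\<close>

lemma poly_to_fls_0: "poly_to_fls 0 = 0"
  by (simp add: poly_to_fls_def)

lemma fls_nth_poly_to_fls_mult:
  "fls_nth (poly_to_fls Q * x) j = (\<Sum>k\<le>degree Q. coeff Q k * fls_nth x (j + int k))"
proof (induction Q arbitrary: j)
  case 0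
  then show ?case by (simp add: poly_to_fls_0)
next
  case (pCons a Q)
  have "poly_to_fls (pCons a Q) * x = fls_const a * x + fls_X_inv * (poly_to_fls Q * x)"
    by (simp add: poly_to_fls_pCons algebra_simps)
  then have "fls_nth (poly_to_fls (pCons a Q) * x) j =
      a * fls_nth x j + fls_nth (poly_to_fls Q * x) (j + 1)"
    by (simp add: fls_X_inv_times_conv_shift)
  then show ?case
    by (cases "Q = 0") (simp_all add: pCons.IH sum.atMost_Suc_shift add.assoc
        poly_to_fls_0 del: sum.atMost_Suc)
qed

lemma enat_le_canc_length_iff:
  "enat n \<le> canc_length x \<longleftrightarrow> (\<forall>j\<in>{1..n}. fls_nth x (int j) = 0)"
proof (cases "\<forall>j\<ge>1. fls_nth x j = 0")
  case True
  then show ?thesis by (simp add: canc_length_def)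
next
  case False
  let ?P = "\<lambda>n. \<forall>j\<in>{1..n}. fls_nth x (int j) = 0"
  from False obtain j where "j \<ge> 1" "fls_nth x j \<noteq> 0" by blast
  then have *: "nat j \<ge> 1" "fls_nth x (int (nat j)) \<noteq> 0" by auto
  have bound: "m \<le> nat j" if "?P m" for m
    using that * by (metis atLeastAtMost_iff linorder_le_cases)
  have "?P (Greatest ?P)"
    by (rule GreatestI_nat[where k = 0 and b = "nat j"]) (use bound in auto)
  moreover have "n \<le> Greatest ?P" if "?P n"
    using that bound by (rule Greatest_le_nat)
  ultimately have "n \<le> Greatest ?P \<longleftrightarrow> ?P n"
    by (meson atLeastAtMost_iff order_trans)
  with False show ?thesis by (simp add: canc_length_def)
qed

text \<open>
  The bridge from Laurent series to recurrences: cancellation depth of \<open>Q\<close> counts how long the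
  recurrence with the coefficients of \<open>Q\<close> holds simultaneously in all the sequences.
\<close>
lemma enat_le_canc_depth_iff:
  assumes "r \<ge> 1"
  shows "enat n \<le> canc_depth r \<alpha> Q \<longleftrightarrow>
    (\<forall>i\<in>{1..r}. \<forall>j\<in>{1..n}.
      (\<Sum>k\<le>degree Q. coeff Q k * fls_nth (\<alpha> i) (int (j + k))) = 0)"
  using assms
  by (simp add: canc_depth_def enat_le_canc_length_iff fls_nth_poly_to_fls_mult)

lemma exists_poly_of_coeffs:
  assumes "a l \<noteq> 0"
  obtains Q :: "'a::zero poly" where "degree Q = l" "\<And>k. k \<le> l \<Longrightarrow> coeff Q k = a k"
proof
  let ?Q = "Poly (map a [0..<Suc l])"
  show coeff: "coeff ?Q k = a k" if "k \<le> l" for k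
    using that by (simp add: coeff_Poly_eq nth_default_def del: upt_Suc)
  show "degree ?Q = l"
  proof (rule antisym)
    show "degree ?Q \<le> l"
      by (rule degree_le) (simp add: coeff_Poly_eq nth_default_def del: upt_Suc)
    show "l \<le> degree ?Q"
      by (rule le_degree) (use assms coeff[of l] in auto)
  qed
qed

lemma joint_lin_complexity_eq_Least_degree:
  assumes "r \<ge> 1"
  shows "joint_lin_complexity r \<alpha> N =
    (LEAST l. l \<le> N \<and> (\<exists>Q. Q \<noteq> 0 \<and> degree Q = l \<and> enat (N - l) \<le> canc_depth r \<alpha> Q))"
proof -
  let ?rec = "\<lambda>l a. a l \<noteq> 0 \<and>
    (\<forall>i\<in>{1..r}. \<forall>j\<in>{1..N - l}. (\<Sum>k\<le>l. a k * fls_nth (\<alpha> i) (int (j + k))) = 0)"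
  have "(\<exists>a. ?rec l a) \<longleftrightarrow>
      (\<exists>Q. Q \<noteq> 0 \<and> degree Q = l \<and> enat (N - l) \<le> canc_depth r \<alpha> Q)" for l
  proof
    assume "\<exists>a. ?rec l a"
    then obtain a where a: "?rec l a" by blast
    then obtain Q where Q: "degree Q = l" "\<And>k. k \<le> l \<Longrightarrow> coeff Q k = a k"
      using exists_poly_of_coeffs[of a l] by blast
    have "Q \<noteq> 0" using a Q(2)[of l] by auto
    moreover have "enat (N - l) \<le> canc_depth r \<alpha> Q"
      using a Q by (simp add: enat_le_canc_depth_iff[OF assms])
    ultimately show "\<exists>Q. Q \<noteq> 0 \<and> degree Q = l \<and> enat (N - l) \<le> canc_depth r \<alpha> Q"
      using Q(1) by blast
  next
    assume "\<exists>Q. Q \<noteq> 0 \<and> degree Q = l \<and> enat (N - l) \<le> canc_depth r \<alpha> Q"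
    then obtain Q where "Q \<noteq> 0" "degree Q = l" "enat (N - l) \<le> canc_depth r \<alpha> Q" by blast
    then have "?rec l (coeff Q)"
      by (auto simp: enat_le_canc_depth_iff[OF assms])
    then show "\<exists>a. ?rec l a" by (intro exI[of _ "coeff Q"])
  qed
  then show ?thesis by (simp add: joint_lin_complexity_def)
qed

lemma joint_lin_complexity_le_degree:
  assumes "r \<ge> 1" "Q \<noteq> 0" "enat n \<le> canc_depth r \<alpha> Q"
  shows "joint_lin_complexity r \<alpha> (n + degree Q) \<le> degree Q"
  unfolding joint_lin_complexity_eq_Least_degree[OF assms(1)]
  by (rule Least_le) (use assms in auto)

lemma joint_lin_complexity_attained:
  assumes "r \<ge> 1"
  obtains Q where "Q \<noteq> 0" "degree Q = joint_lin_complexity r \<alpha> N"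
    "joint_lin_complexity r \<alpha> N \<le> N"
    "enat (N - joint_lin_complexity r \<alpha> N) \<le> canc_depth r \<alpha> Q"
proof -
  let ?P = "\<lambda>l. l \<le> N \<and> (\<exists>Q. Q \<noteq> 0 \<and> degree Q = l \<and> enat (N - l) \<le> canc_depth r \<alpha> Q)"
  \<comment> \<open>A recurrence of length \<open>N\<close> constrains none of the first \<open>N\<close> terms.\<close>
  have "?P N"
    by (intro conjI exI[of _ "monom 1 N"]) (simp_all add: degree_monom_eq zero_enat_def[symmetric])
  then have "?P (Least ?P)" by (rule LeastI)
  then show ?thesis
    using that unfolding joint_lin_complexity_eq_Least_degree[OF assms] by blast
qed

text \<open>
  Multiplication by \<open>t\<^sup>a\<close> shifts the sequences by \<open>a\<close>. Over a finite field there are only finitely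
  many windows of length \<open>n\<close>, so two distinct shifts \<open>a\<close>, \<open>b\<close> share the same initial window, and
  \<open>t\<^sup>a - t\<^sup>b\<close> cancels it.
\<close>
lemma exists_canc_depth_ge:
  fixes \<alpha> :: "nat \<Rightarrow> 'a::{field,finite} fls"
  assumes "r \<ge> 1"
  shows "\<exists>Q. Q \<noteq> 0 \<and> enat n \<le> canc_depth r \<alpha> Q"
proof -
  let ?w = "\<lambda>a. \<lambda>(i, j)\<in>{1..r} \<times> {1..n}. fls_nth (\<alpha> i) (int (j + a))"
  have "range ?w \<subseteq> PiE ({1..r} \<times> {1..n}) (\<lambda>_. UNIV)"
    by (intro image_subsetI, unfold restrict_PiE_iff) simp
  then have "finite (range ?w)"
    by (rule finite_subset) (auto intro: finite_PiE)
  then have "\<not> inj ?w"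
    using finite_imageD infinite_UNIV_nat by blast
  then obtain a b where ab: "a \<noteq> b" "?w a = ?w b" by (auto simp: inj_def)
  let ?Q = "monom 1 a - monom 1 b :: 'a poly"
  have "coeff ?Q a \<noteq> 0" using ab by simp
  then have "?Q \<noteq> 0" by (metis coeff_0)
  moreover have "fls_nth (poly_to_fls ?Q * \<alpha> i) (int j) = 0"
    if "i \<in> {1..r}" "j \<in> {1..n}" for i j
  proof -
    have monom: "fls_nth (poly_to_fls (monom 1 m) * \<alpha> i) (int j) = fls_nth (\<alpha> i) (int (j + m))"
      for m
      by (simp add: fls_nth_poly_to_fls_mult degree_monom_eq if_distrib[of "\<lambda>c. c * _"]
          cong: if_cong)
    have "poly_to_fls ?Q = poly_to_fls (monom 1 a) - poly_to_fls (monom 1 b)"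
      by (rule fls_eqI) (simp add: poly_to_fls_nth)
    moreover have "fls_nth (\<alpha> i) (int (j + a)) = fls_nth (\<alpha> i) (int (j + b))"
      using fun_cong[OF ab(2), of "(i, j)"] that by simp
    ultimately show ?thesis using monom by (simp add: left_diff_distrib)
  qed
  then have "enat n \<le> canc_depth r \<alpha> ?Q"
    using assms by (simp add: canc_depth_def enat_le_canc_length_iff)
  ultimately show ?thesis by blast
qed

lemma joint_lin_complexity_min_poly_d:
  fixes \<alpha> :: "nat \<Rightarrow> 'a::{field,finite} fls"
  assumes "r \<ge> 1"
  shows "joint_lin_complexity r \<alpha> (n + min_poly_d r \<alpha> n - 1) = min_poly_d r \<alpha> n - 1"
proof -
  let ?P = "\<lambda>d. \<exists>Q. Q \<noteq> 0 \<and> enat n \<le> canc_depth r \<alpha> Q \<and> d = poly_d Q"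
  have min: "min_poly_d r \<alpha> n = Least ?P" by (simp add: min_poly_d_def)
  have "\<exists>d. ?P d" using exists_canc_depth_ge[OF assms] by blast
  then have "?P (Least ?P)" by (rule LeastI_ex)
  then obtain Q where Q: "Q \<noteq> 0" "enat n \<le> canc_depth r \<alpha> Q" "min_poly_d r \<alpha> n = poly_d Q"
    unfolding min by blast
  then have d: "min_poly_d r \<alpha> n = degree Q + 1" by (simp add: poly_d_def)
  let ?l = "joint_lin_complexity r \<alpha> (n + degree Q)"
  have le: "?l \<le> degree Q" using assms Q by (intro joint_lin_complexity_le_degree)
  obtain Q' where Q': "Q' \<noteq> 0" "degree Q' = ?l"
    "enat (n + degree Q - ?l) \<le> canc_depth r \<alpha> Q'"
    using joint_lin_complexity_attained[OF assms] by metis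
  \<comment> \<open>The competitor has length at most \<open>deg Q\<close>, hence depth at least \<open>n\<close>, so minimality applies.\<close>
  have "enat n \<le> enat (n + degree Q - ?l)" using le by simp
  then have "enat n \<le> canc_depth r \<alpha> Q'" using Q'(3) by (rule order_trans)
  then have "Least ?P \<le> poly_d Q'" using Q'(1) by (intro Least_le) blast
  then have "degree Q \<le> ?l" using d Q'(2) unfolding min by (simp add: poly_d_def)
  with le d show ?thesis by simp
qed

lemma finite_degree_le: "finite {Q :: 'a::{zero,finite} poly. degree Q \<le> n}"
proof -
  have "Q \<in> Poly ` {xs. set xs \<subseteq> UNIV \<and> length xs \<le> n + 1}" if "degree Q \<le> n" for Q :: "'a poly"
    using that by (cases "Q = 0")
      (auto simp: length_coeffs_degree intro!: image_eqI[of _ _ "coeffs Q"])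
  then show ?thesis
    by (intro finite_subset[OF _ finite_imageI[OF finite_lists_length_le[OF finite_UNIV]]]) blast
qed

lemma max_canc_gain_is_max_of:
  fixes \<alpha> :: "nat \<Rightarrow> 'a::{field,finite} fls"
  assumes "D \<ge> 1"
  shows "is_max_of
    ((\<lambda>Q. ereal (real r) * ereal_of_enat (canc_depth r \<alpha> Q) - ereal (real (poly_d Q)))
      ` {Q. Q \<noteq> 0 \<and> poly_d Q \<le> D}) (max_canc_gain r \<alpha> D)"
proof -
  have "finite {Q :: 'a poly. Q \<noteq> 0 \<and> poly_d Q \<le> D}"
    by (rule finite_subset[OF _ finite_degree_le[of D]]) (auto simp: poly_d_def)
  moreover have "1 \<in> {Q :: 'a poly. Q \<noteq> 0 \<and> poly_d Q \<le> D}"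
    using assms by (simp add: poly_d_def)
  ultimately show ?thesis
    unfolding is_max_of_def max_canc_gain_def by (blast intro: Max_in Max_ge finite_imageI)
qed

text \<open>
  The set of gains and the set of values at the \<open>N\<close> are not equal in general: a polynomial need
  not be a shortest recurrence for the window that it cancels. Domination in both directions does
  hold, and it transports the existence of the maximum as well as its value.
\<close>
lemma is_max_of_cofinal:
  assumes "is_max_of S m" "\<And>x. x \<in> S \<Longrightarrow> \<exists>y\<in>T. x \<le> y" "\<And>y. y \<in> T \<Longrightarrow> \<exists>x\<in>S. y \<le> x"
  shows "is_max_of T m"
proof -
  have ub: "y \<le> m" if "y \<in> T" for y
    using assms(1,3) that unfolding is_max_of_def by (meson order_trans)
  obtain y where "y \<in> T" "m \<le> y"
    using assms(1,2) unfolding is_max_of_def by blast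
  then have "m \<in> T" using ub[of y] by simp
  with ub show ?thesis by (simp add: is_max_of_def)
qed

lemma max_canc_gain_eq_joint_lin_complexity:
  fixes \<alpha> :: "nat \<Rightarrow> 'a::{field,finite} fls"
  assumes r: "r \<ge> 1" and fin: "\<not> (\<exists>Q. Q \<noteq> 0 \<and> canc_depth r \<alpha> Q = \<infinity>)" and D: "D \<ge> 1"
  shows "is_max_of
    {ereal (real r * real N - (real r + 1) * real (joint_lin_complexity r \<alpha> N) - 1) | N.
      joint_lin_complexity r \<alpha> N + 1 \<le> D}
    (max_canc_gain r \<alpha> D)" (is "is_max_of ?T _")
proof (rule is_max_of_cofinal[OF max_canc_gain_is_max_of[OF D]])
  let ?gain = "\<lambda>Q. ereal (real r) * ereal_of_enat (canc_depth r \<alpha> Q) - ereal (real (poly_d Q))"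
  have gain: "?gain Q = ereal (real r * real m - real (degree Q) - 1)"
    if "canc_depth r \<alpha> Q = enat m" for Q m
    using that by (simp add: poly_d_def)
  {
    fix x assume "x \<in> ?gain ` {Q. Q \<noteq> 0 \<and> poly_d Q \<le> D}"
    then obtain Q where Q: "Q \<noteq> 0" "degree Q + 1 \<le> D" "x = ?gain Q"
      by (auto simp: poly_d_def)
    obtain m where m: "canc_depth r \<alpha> Q = enat m"
      using fin Q(1) by (metis enat.exhaust)
    let ?l = "joint_lin_complexity r \<alpha> (m + degree Q)"
    have le: "?l \<le> degree Q"
      using r Q(1) m by (intro joint_lin_complexity_le_degree) simp_all
    then have "(real r + 1) * real ?l \<le> (real r + 1) * real (degree Q)"
      by (intro mult_left_mono) simp_all
    then have "x \<le> ereal (real r * real (m + degree Q) - (real r + 1) * real ?l - 1)"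
      unfolding Q(3) gain[OF m] by (simp add: algebra_simps)
    moreover have "?l + 1 \<le> D" using le Q(2) by simp
    ultimately show "\<exists>y\<in>?T. x \<le> y" by blast
  next
    fix y assume "y \<in> ?T"
    then obtain N where N: "joint_lin_complexity r \<alpha> N + 1 \<le> D"
      "y = ereal (real r * real N - (real r + 1) * real (joint_lin_complexity r \<alpha> N) - 1)"
      by blast
    let ?l = "joint_lin_complexity r \<alpha> N"
    obtain Q where Q: "Q \<noteq> 0" "degree Q = ?l" "?l \<le> N" "enat (N - ?l) \<le> canc_depth r \<alpha> Q"
      using joint_lin_complexity_attained[OF r] by metis
    obtain m where m: "canc_depth r \<alpha> Q = enat m"
      using fin Q(1) by (metis enat.exhaust)
    have "real N - real ?l \<le> real m" using Q(3,4) m by simp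
    then have "real r * (real N - real ?l) \<le> real r * real m"
      by (intro mult_left_mono) simp_all
    then have "y \<le> ?gain Q"
      unfolding N(2) gain[OF m] by (simp add: Q(2) algebra_simps)
    moreover have "poly_d Q \<le> D" using Q(2) N(1) by (simp add: poly_d_def)
    ultimately show "\<exists>x\<in>?gain ` {Q. Q \<noteq> 0 \<and> poly_d Q \<le> D}. y \<le> x"
      using Q(1) by blast
  }
qed

theorem proposition1p4:
  fixes \<alpha> :: "nat \<Rightarrow> 'a::{field,finite} fls" and r :: nat
  assumes "r \<ge> 1"
    and "\<And>i. i \<in> {1..r} \<Longrightarrow> \<alpha> i \<in> frak_p"
  shows "(\<forall>n d N. d = min_poly_d r \<alpha> n \<longrightarrow> N = n + d - 1 \<longrightarrow> joint_lin_complexity r \<alpha> N = d - 1) \<and>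
    ((\<not> (\<exists>Q. Q \<noteq> 0 \<and> canc_depth r \<alpha> Q = \<infinity>)) \<longrightarrow>
      (\<forall>D\<ge>1. is_max_of
        {ereal (real r * real N - (real r + 1) * real (joint_lin_complexity r \<alpha> N) - 1) | N.
           joint_lin_complexity r \<alpha> N + 1 \<le> D}
        (max_canc_gain r \<alpha> D)))"
  using joint_lin_complexity_min_poly_d[OF assms(1)]
    max_canc_gain_eq_joint_lin_complexity[OF assms(1)]
  by blast

end
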